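(* Let $t,\ell,k,d$ be positive integers. Let $G$ be a graph having an $H$-partition of layered width at most $\ell$ in which $H$ has treewidth at most $t$, and let $\mathcal{P}$ be a $(k,d)$-shortcut system for $G$. Then $G^{\mathcal{P}}$ has a $J$-partition of layered width at most $d\ell(k^3+3k)$ for some graph $J$ of treewidth at most $\binom{k+t}{t}-1$.
   Context: A layering of a graph $G$ is a sequence $\langle L_0,L_1,\ldots\rangle$ of sets partitioning $V(G)$ such that for every edge $vw$ with $v\in L_i$, $w\in L_j$ we have $|i-j|\leq 1$. For a partition $\{S_x : x\in V(H)\}$ of $V(G)$ indexed by the vertices of a graph $H$, it is an $H$-partition if $H$ is the quotient graph: $xy\in E(H)$ iff $x\neq y$ and there is an edge $vw\in E(G)$ with $v\in S_x$, $w\in S_y$. The layered width of a partition $\mathcal{S}$ with respect to a layering $\mathcal{L}$ is $\max\{|L\cap S|: L\in\mathcal{L}, S\in\mathcal{S}\}$; the layered width of $\mathcal{S}$ is the minimum of this over all layerings of $G$. A non-empty set $\mathcal{P}$ of paths of length at least 1 in $G$ is a $(k,d)$-shortcut system if every path has length (number of edges) at most $k$ and each vertex of $G$ is an internal vertex of at most $d$ paths in $\mathcal{P}$. $G^{\mathcal{P}}$ is the supergraph of $G$ obtained by adding the edge $vw$ for each path in $\mathcal{P}$ with endpoints $v,w$. *)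

theory Defs
  imports Main
begin

definition sgraph :: "'a set \<Rightarrow> 'a set set \<Rightarrow> bool" where
  "sgraph V E \<longleftrightarrow> finite V \<and> (\<forall>e\<in>E. \<exists>u v. e = {u, v} \<and> u \<noteq> v \<and> u \<in> V \<and> v \<in> V)"

text \<open>A path is a nonempty list of distinct vertices with consecutive vertices adjacent;
  its length is the number of edges, i.e. length minus one.\<close>
definition is_path :: "'a set \<Rightarrow> 'a set set \<Rightarrow> 'a list \<Rightarrow> bool" where
  "is_path V E xs \<longleftrightarrow> xs \<noteq> [] \<and> set xs \<subseteq> V \<and> distinct xs \<and>
     (\<forall>i. Suc i < length xs \<longrightarrow> {xs ! i, xs ! Suc i} \<in> E)"

definition internal_vertices :: "'a list \<Rightarrow> 'a set" where
  "internal_vertices xs = set (butlast (tl xs))"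

definition sconnected :: "'a set \<Rightarrow> 'a set set \<Rightarrow> bool" where
  "sconnected V E \<longleftrightarrow> (\<forall>u\<in>V. \<forall>v\<in>V. \<exists>xs. is_path V E xs \<and> hd xs = u \<and> last xs = v)"

definition has_cycle :: "'a set \<Rightarrow> 'a set set \<Rightarrow> bool" where
  "has_cycle V E \<longleftrightarrow> (\<exists>xs. 3 \<le> length xs \<and> is_path V E xs \<and> {last xs, hd xs} \<in> E)"

definition is_tree :: "'a set \<Rightarrow> 'a set set \<Rightarrow> bool" where
  "is_tree V E \<longleftrightarrow> sgraph V E \<and> V \<noteq> {} \<and> sconnected V E \<and> \<not> has_cycle V E"

text \<open>Tree decompositions (tree nodes labelled by naturals, which is no loss for finite trees).\<close>
definition tree_decomposition ::
  "'a set \<Rightarrow> 'a set set \<Rightarrow> nat set \<Rightarrow> nat set set \<Rightarrow> (nat \<Rightarrow> 'a set) \<Rightarrow> bool" where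
  "tree_decomposition V E T F B \<longleftrightarrow>
     is_tree T F \<and>
     (\<forall>x\<in>T. B x \<subseteq> V) \<and>
     (\<forall>v\<in>V. \<exists>x\<in>T. v \<in> B x) \<and>
     (\<forall>e\<in>E. \<exists>x\<in>T. e \<subseteq> B x) \<and>
     (\<forall>v\<in>V. sconnected {x\<in>T. v \<in> B x} {f\<in>F. f \<subseteq> {x\<in>T. v \<in> B x}})"

definition treewidth_le :: "'a set \<Rightarrow> 'a set set \<Rightarrow> nat \<Rightarrow> bool" where
  "treewidth_le V E w \<longleftrightarrow>
     (\<exists>T F B. tree_decomposition V E T F B \<and> (\<forall>x\<in>T. card (B x) \<le> w + 1))"

definition layering :: "'a set \<Rightarrow> 'a set set \<Rightarrow> (nat \<Rightarrow> 'a set) \<Rightarrow> bool" where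
  "layering V E L \<longleftrightarrow>
     (\<Union>i. L i) = V \<and> (\<forall>i j. i \<noteq> j \<longrightarrow> L i \<inter> L j = {}) \<and>
     (\<forall>i j v w. {v, w} \<in> E \<and> v \<in> L i \<and> w \<in> L j \<longrightarrow> \<bar>int i - int j\<bar> \<le> 1)"

definition H_partition ::
  "'a set \<Rightarrow> 'a set set \<Rightarrow> 'b set \<Rightarrow> 'b set set \<Rightarrow> ('b \<Rightarrow> 'a set) \<Rightarrow> bool" where
  "H_partition V E VH EH S \<longleftrightarrow>
     sgraph VH EH \<and>
     (\<forall>x\<in>VH. S x \<noteq> {}) \<and>
     (\<Union>x\<in>VH. S x) = V \<and>
     (\<forall>x\<in>VH. \<forall>y\<in>VH. x \<noteq> y \<longrightarrow> S x \<inter> S y = {}) \<and>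
     (\<forall>x\<in>VH. \<forall>y\<in>VH. {x, y} \<in> EH \<longleftrightarrow> (x \<noteq> y \<and> (\<exists>v\<in>S x. \<exists>w\<in>S y. {v, w} \<in> E)))"

definition layered_width_le ::
  "'a set \<Rightarrow> 'a set set \<Rightarrow> 'b set \<Rightarrow> ('b \<Rightarrow> 'a set) \<Rightarrow> nat \<Rightarrow> bool" where
  "layered_width_le V E VH S l \<longleftrightarrow>
     (\<exists>L. layering V E L \<and> (\<forall>i. \<forall>x\<in>VH. card (L i \<inter> S x) \<le> l))"

definition shortcut_system ::
  "'a set \<Rightarrow> 'a set set \<Rightarrow> 'a list set \<Rightarrow> nat \<Rightarrow> nat \<Rightarrow> bool" where
  "shortcut_system V E P k d \<longleftrightarrow>
     P \<noteq> {} \<and>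
     (\<forall>p\<in>P. is_path V E p \<and> 2 \<le> length p \<and> length p - 1 \<le> k) \<and>
     (\<forall>v\<in>V. card {p\<in>P. v \<in> internal_vertices p} \<le> d)"

definition shortcut_edges :: "'a set set \<Rightarrow> 'a list set \<Rightarrow> 'a set set" where
  "shortcut_edges E P = E \<union> {{hd p, last p} | p. p \<in> P}"

end

theory Submission
  imports Defs
begin

text \<open>A vertex ordering of \<open>H\<close> obtained from a rooted tree decomposition is a perfect elimination
  ordering of a chordal supergraph of \<open>H\<close> in which every vertex has at most \<open>t\<close> earlier neighbours,
  and at most \<open>k + t\<close> choose \<open>t\<close> vertices are reached from a given one by at most \<open>k\<close>
  steps to earlier neighbours. Move each vertex \<open>v\<close> of \<open>G\<close> to the earliest part among its own part and
  the parts of internal vertices of paths through \<open>v\<close>. Those parts form a connected subgraph of \<open>H\<close>,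
  so the new part is reached from the old one in at most \<open>k - 1\<close> steps. Hence the sets of vertices
  reached in at most \<open>k\<close> steps are the bags of a tree decomposition of the new quotient \<open>J\<close>. For the
  width, merge every \<open>k\<close> consecutive layers: a vertex moved into a part lies, with at most \<open>k\<close> other
  vertices, on one of \<open>d\<close> paths through a vertex of the old part in one of \<open>3 k - 2\<close> layers, and
  \<open>k + (3 k - 2) (k + 1) \<le> k\<^sup>3 + 3 k\<close>.\<close>

section \<open>Rooted tree decompositions\<close>

lemma is_path_Cons:
  "is_path V E (x # y # xs) \<longleftrightarrow>
     x \<in> V \<and> x \<notin> set (y # xs) \<and> {x, y} \<in> E \<and> is_path V E (y # xs)"
proof -
  have all_nat: "(\<forall>i. Q i) \<longleftrightarrow> Q 0 \<and> (\<forall>i. Q (Suc i))" for Q :: "nat \<Rightarrow> bool"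
    by (metis nat.exhaust)
  have "(\<forall>i. Suc i < length (x # y # xs) \<longrightarrow> {(x # y # xs) ! i, (x # y # xs) ! Suc i} \<in> E) \<longleftrightarrow>
    {x, y} \<in> E \<and> (\<forall>i. Suc i < length (y # xs) \<longrightarrow> {(y # xs) ! i, (y # xs) ! Suc i} \<in> E)"
    using all_nat[of "\<lambda>i. Suc i < length (x # y # xs) \<longrightarrow>
      {(x # y # xs) ! i, (x # y # xs) ! Suc i} \<in> E"] by simp
  then show ?thesis unfolding is_path_def by auto
qed

lemma is_path_singleton: "is_path V E [x] \<longleftrightarrow> x \<in> V"
  unfolding is_path_def by auto

lemma is_path_suffix:
  assumes "is_path V E (xs @ ys)" and "ys \<noteq> []"
  shows "is_path V E ys"
  using assms
proof (induction xs)
  case (Cons x xs)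
  then obtain z zs where "xs @ ys = z # zs" by (cases "xs @ ys") auto
  with Cons show ?case by (simp add: is_path_Cons)
qed simp

text \<open>Connectivity is handled through the reflexive transitive closure of this relation, since
  walks can be extended without the distinctness that \<open>is_path\<close> demands.\<close>

definition adj_rel :: "'a set \<Rightarrow> 'a set set \<Rightarrow> ('a \<times> 'a) set" where
  "adj_rel V E = {(u, v). u \<in> V \<and> v \<in> V \<and> {u, v} \<in> E}"

lemma sym_adj_rel: "sym (adj_rel V E)"
  unfolding adj_rel_def sym_def by (auto simp: insert_commute)

lemma adj_rel_path:
  assumes "(u, v) \<in> (adj_rel V E)\<^sup>*" and "v \<in> V"
  shows "\<exists>xs. is_path V E xs \<and> hd xs = u \<and> last xs = v"
  using assms
proof (induction rule: converse_rtrancl_induct)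
  case base
  then show ?case by (intro exI[of _ "[v]"]) (simp add: is_path_singleton)
next
  case (step u w)
  then obtain xs where xs: "is_path V E xs" "hd xs = w" "last xs = v" by blast
  then obtain ys where ys: "xs = w # ys" unfolding is_path_def by (cases xs) auto
  show ?case
  proof (cases "u \<in> set xs")
    \<comment> \<open>If \<open>u\<close> already lies on the path, the piece before
      \<open>u\<close> is cut off instead of visiting \<open>u\<close> twice.\<close>
    case True
    then obtain as bs where ab: "xs = as @ u # bs" by (meson split_list)
    then have "is_path V E (u # bs)" using xs(1) is_path_suffix by blast
    then show ?thesis using ab xs(3) by (intro exI[of _ "u # bs"]) simp
  next
    case False
    then have "is_path V E (u # xs)"
      using step.hyps(1) xs(1) ys by (auto simp: is_path_Cons adj_rel_def)
    then show ?thesis using xs ys by (intro exI[of _ "u # xs"]) simp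
  qed
qed

lemma path_adj_rel:
  assumes "is_path V E xs"
  shows "(hd xs, last xs) \<in> (adj_rel V E)\<^sup>*"
  using assms
proof (induction xs)
  case (Cons x xs)
  show ?case
  proof (cases xs)
    case (Cons y ys)
    then have "(x, y) \<in> adj_rel V E" "is_path V E xs"
      using Cons.prems by (auto simp: is_path_Cons adj_rel_def is_path_def)
    then show ?thesis using Cons.IH Cons by (simp add: converse_rtrancl_into_rtrancl)
  qed simp
qed (simp add: is_path_def)

lemma sconnected_iff:
  "sconnected V E \<longleftrightarrow> (\<forall>u\<in>V. \<forall>v\<in>V. (u, v) \<in> (adj_rel V E)\<^sup>*)"
  unfolding sconnected_def using adj_rel_path path_adj_rel by metis

lemma sconnected_if_root:
  assumes "\<And>u. u \<in> V \<Longrightarrow> (u, r) \<in> (adj_rel V E)\<^sup>*"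
  shows "sconnected V E"
  unfolding sconnected_iff
  using assms sym_rtrancl[OF sym_adj_rel, of V E] by (meson rtrancl_trans symD)

section \<open>Trees on an initial segment of the naturals, with root 0 and smaller parents\<close>

definition parent_fun :: "nat \<Rightarrow> (nat \<Rightarrow> nat) \<Rightarrow> bool" where
  "parent_fun m p \<longleftrightarrow> (\<forall>i. 0 < i \<and> i < m \<longrightarrow> p i < i)"

definition parent_edges :: "nat \<Rightarrow> (nat \<Rightarrow> nat) \<Rightarrow> nat set set" where
  "parent_edges m p = {{i, p i} | i. 0 < i \<and> i < m}"

text \<open>Following parents decreases the number, and inside \<open>X\<close> the descent can only
  stop at \<open>r\<close>. It serves for the whole tree with \<open>r = 0\<close> and for the nodes
  whose bags contain a fixed vertex.\<close>

lemma parent_closed_reaches_root: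
  assumes p: "parent_fun m p" and X: "X \<subseteq> {..<m}" and r: "r \<in> X"
    and cl: "\<And>i. i \<in> X \<Longrightarrow> i \<noteq> r \<Longrightarrow> r < i \<and> p i \<in> X" and "i \<in> X"
  shows "(i, r) \<in> (adj_rel X {f \<in> parent_edges m p. f \<subseteq> X})\<^sup>*"
  using \<open>i \<in> X\<close>
proof (induction i rule: less_induct)
  case (less i)
  show ?case
  proof (cases "i = r")
    case False
    then have i: "r < i" "p i \<in> X" using cl less.prems by auto
    moreover have "i < m" using X less.prems by auto
    ultimately have "p i < i" "{i, p i} \<in> parent_edges m p"
      using p unfolding parent_fun_def parent_edges_def by auto
    then have "(i, p i) \<in> adj_rel X {f \<in> parent_edges m p. f \<subseteq> X}"
      using i less.prems unfolding adj_rel_def by auto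
    then show ?thesis using less.IH[OF \<open>p i < i\<close> i(2)]
      by (rule converse_rtrancl_into_rtrancl)
  qed simp
qed

lemma parent_edges_tree:
  assumes m: "0 < m" and p: "parent_fun m p"
  shows "is_tree {..<m} (parent_edges m p)"
proof -
  have F: "f \<subseteq> {..<m}" if "f \<in> parent_edges m p" for f
    using that p unfolding parent_edges_def parent_fun_def by fastforce
  then have eq: "{f \<in> parent_edges m p. f \<subseteq> {..<m}} = parent_edges m p" by blast
  have "(i, 0) \<in> (adj_rel {..<m} (parent_edges m p))\<^sup>*" if "i \<in> {..<m}" for i
  proof -
    have "0 < j \<and> p j \<in> {..<m}" if "j \<in> {..<m}" "j \<noteq> 0" for j
      using p that unfolding parent_fun_def by fastforce
    then show ?thesis
      using parent_closed_reaches_root[OF p, of "{..<m}" 0 i] m that eq by auto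
  qed
  then have conn: "sconnected {..<m} (parent_edges m p)" by (rule sconnected_if_root)
  have sg: "sgraph {..<m} (parent_edges m p)"
    unfolding sgraph_def
  proof (intro conjI ballI)
    fix f assume "f \<in> parent_edges m p"
    then obtain i where "f = {i, p i}" "0 < i" "i < m" unfolding parent_edges_def by auto
    moreover then have "p i < i" using p unfolding parent_fun_def by auto
    ultimately show "\<exists>u v. f = {u, v} \<and> u \<noteq> v \<and> u \<in> {..<m} \<and> v \<in> {..<m}"
      by (intro exI[of _ i] exI[of _ "p i"]) auto
  qed simp
  \<comment> \<open>An edge joins a node to its parent, so a node has at most one neighbour that
    does not exceed it.\<close>
  have nb: "y = p x" if "{x, y} \<in> parent_edges m p" "y \<le> x" for x y
  proof -
    obtain i where i: "{x, y} = {i, p i}" "0 < i" "i < m"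
      using \<open>{x, y} \<in> _\<close> unfolding parent_edges_def by auto
    then have "p i < i" using p unfolding parent_fun_def by auto
    then show ?thesis using i \<open>y \<le> x\<close> by (auto simp: doubleton_eq_iff)
  qed
  have "\<not> has_cycle {..<m} (parent_edges m p)"
  proof
    assume "has_cycle {..<m} (parent_edges m p)"
    then obtain xs where xs: "3 \<le> length xs" "is_path {..<m} (parent_edges m p) xs"
      "{last xs, hd xs} \<in> parent_edges m p" unfolding has_cycle_def by blast
    define n where "n = length xs"
    have d: "distinct xs" and ne: "xs \<noteq> []" using xs(2) unfolding is_path_def by auto
    \<comment> \<open>Both neighbours on the cycle of its largest vertex have to be the parent of that vertex.\<close>
    define M where "M = Max (set xs)"
    have "M \<in> set xs" using ne unfolding M_def by simp
    then obtain s where s: "s < n" "xs ! s = M" unfolding n_def by (auto simp: in_set_conv_nth)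
    have le: "xs ! i \<le> M" if "i < n" for i using that unfolding n_def M_def by simp
    \<comment> \<open>Cyclic indices make the closing edge of the cycle an ordinary step. Below,
      \<open>s + n\<close> replaces \<open>s\<close> so that the predecessor also exists for
      \<open>s = 0\<close>.\<close>
    define cyc where "cyc i = xs ! (i mod n)" for i
    have cyc: "{cyc i, cyc (Suc i)} \<in> parent_edges m p" for i
    proof (cases "Suc (i mod n) = n")
      case True
      then have "i mod n = n - 1" "Suc i mod n = 0" by (auto simp: mod_Suc)
      then show ?thesis using xs(3) ne unfolding cyc_def n_def
        by (simp add: last_conv_nth hd_conv_nth)
    next
      case False
      moreover have "i mod n < n" using s by simp
      ultimately have "Suc (i mod n) < n" by simp
      moreover have "Suc i mod n = Suc (i mod n)" using False by (simp add: mod_Suc)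
      ultimately show ?thesis using xs(2) unfolding cyc_def n_def is_path_def by simp
    qed
    have n: "3 \<le> n" using xs(1) unfolding n_def .
    have M1: "cyc (s + n) = M" using s unfolding cyc_def by simp
    have up: "cyc i \<le> M" for i unfolding cyc_def using le n by simp
    have "cyc (Suc (s + n)) = p M" using nb[of M "cyc (Suc (s + n))"] cyc[of "s + n"] M1 up by simp
    moreover have "cyc (s + n - 1) = p M"
      using nb[of M "cyc (s + n - 1)"] cyc[of "s + n - 1"] M1 up n by (simp add: insert_commute)
    ultimately have "Suc (s + n) mod n = (s + n - 1) mod n"
      using nth_eq_iff_index_eq[OF d, of "Suc (s + n) mod n" "(s + n - 1) mod n"] n
      unfolding cyc_def n_def[symmetric] by simp
    then have "n dvd Suc (s + n) - (s + n - 1)"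
      by (metis diff_le_self le_Suc_eq mod_eq_dvd_iff_nat)
    moreover have "Suc (s + n) - (s + n - 1) = 2" using n by simp
    ultimately show False using n by (auto dest: dvd_imp_le)
  qed
  then show ?thesis using conn sg m unfolding is_tree_def by auto
qed

text \<open>\<open>r v\<close> is the topmost node whose bag contains \<open>v\<close>. That every
  other such node hands \<open>v\<close> to its parent replaces connectivity of these nodes and
  suits induction on node numbers.\<close>

definition rooted_decomposition ::
  "'a set \<Rightarrow> 'a set set \<Rightarrow> nat \<Rightarrow> (nat \<Rightarrow> nat) \<Rightarrow> (nat \<Rightarrow> 'a set) \<Rightarrow> ('a \<Rightarrow> nat) \<Rightarrow> bool" where
  "rooted_decomposition V E m p B r \<longleftrightarrow>
     0 < m \<and> parent_fun m p \<and> (\<forall>i<m. B i \<subseteq> V) \<and>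
     (\<forall>e\<in>E. \<exists>i<m. e \<subseteq> B i) \<and>
     (\<forall>v\<in>V. r v < m \<and> v \<in> B (r v) \<and>
        (\<forall>i<m. v \<in> B i \<and> i \<noteq> r v \<longrightarrow> r v < i \<and> v \<in> B (p i)))"

lemma treewidth_le_if_rooted:
  assumes D: "rooted_decomposition V E m p B r" and w: "\<And>i. i < m \<Longrightarrow> card (B i) \<le> w + 1"
  shows "treewidth_le V E w"
proof -
  have m: "0 < m" and p: "parent_fun m p" using D unfolding rooted_decomposition_def by auto
  have "sconnected {x \<in> {..<m}. v \<in> B x}
      {f \<in> parent_edges m p. f \<subseteq> {x \<in> {..<m}. v \<in> B x}}" if "v \<in> V" for v
  proof (rule sconnected_if_root)
    fix i assume i: "i \<in> {x \<in> {..<m}. v \<in> B x}"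
    have R: "r v < m" "v \<in> B (r v)"
      "\<And>j. j < m \<Longrightarrow> v \<in> B j \<Longrightarrow> j \<noteq> r v \<Longrightarrow> r v < j \<and> v \<in> B (p j)"
      using D \<open>v \<in> V\<close> unfolding rooted_decomposition_def by auto
    show "(i, r v) \<in> (adj_rel {x \<in> {..<m}. v \<in> B x}
      {f \<in> parent_edges m p. f \<subseteq> {x \<in> {..<m}. v \<in> B x}})\<^sup>*"
    proof (rule parent_closed_reaches_root[OF p _ _ _ i])
      fix j assume j: "j \<in> {x \<in> {..<m}. v \<in> B x}" "j \<noteq> r v"
      then have "r v < j" "v \<in> B (p j)" "j < m" using R(3) by auto
      moreover then have "p j < j" using p unfolding parent_fun_def by auto
      ultimately show "r v < j \<and> p j \<in> {x \<in> {..<m}. v \<in> B x}" by auto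
    qed (use R in auto)
  qed
  then have "tree_decomposition V E {..<m} (parent_edges m p) B"
    using D parent_edges_tree[OF m p]
    unfolding tree_decomposition_def rooted_decomposition_def by (auto simp: Bex_def)
  then show ?thesis unfolding treewidth_le_def using w by blast
qed

section \<open>From arbitrary tree decompositions to rooted ones\<close>

lemma rtrancl_crossing:
  assumes "(u, v) \<in> R\<^sup>*" and "u \<in> A" and "v \<notin> A"
  shows "\<exists>x y. (x, y) \<in> R \<and> x \<in> A \<and> y \<notin> A"
  using assms by (induction rule: rtrancl_induct) blast+

text \<open>While a vertex of \<open>T\<close> is missing, connectivity yields an edge leaving the
  enumerated set; its outer end comes next, with the inner end as parent.\<close>

lemma connected_enumeration:
  assumes fin: "finite T" and conn: "sconnected T F" and "0 < n" and "n \<le> card T"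
  shows "\<exists>g p. inj_on g {..<n} \<and> g ` {..<n} \<subseteq> T \<and> parent_fun n p \<and>
           (\<forall>i. 0 < i \<and> i < n \<longrightarrow> {g i, g (p i)} \<in> F)"
  using \<open>0 < n\<close> \<open>n \<le> card T\<close>
proof (induction n rule: nat_induct_non_zero)
  case 1
  then obtain z where "z \<in> T" by (metis card.empty ex_in_conv not_one_le_zero)
  then show ?case
    by (intro exI[of _ "\<lambda>_. z"] exI[of _ id]) (auto simp: parent_fun_def inj_on_def)
next
  case (Suc n)
  then obtain g p where g: "inj_on g {..<n}" "g ` {..<n} \<subseteq> T" and p: "parent_fun n p"
    and e: "\<forall>i. 0 < i \<and> i < n \<longrightarrow> {g i, g (p i)} \<in> F" by auto
  have "card (g ` {..<n}) = n" using g(1) by (simp add: card_image)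
  then have "g ` {..<n} \<noteq> T" using Suc.prems by auto
  then obtain z where z: "z \<in> T" "z \<notin> g ` {..<n}" using g(2) by blast
  have "(g 0, z) \<in> (adj_rel T F)\<^sup>*" using conn z g(2) Suc.hyps by (auto simp: sconnected_iff)
  then obtain x y where xy: "(x, y) \<in> adj_rel T F" "x \<in> g ` {..<n}" "y \<notin> g ` {..<n}"
    using rtrancl_crossing[of "g 0" z "adj_rel T F" "g ` {..<n}"] z Suc.hyps by auto
  then obtain j where j: "j < n" "x = g j" by auto
  have "inj_on (g(n := y)) {..<Suc n}"
    using g(1) xy(3) by (auto simp: inj_on_def less_Suc_eq)
  moreover have "(g(n := y)) ` {..<Suc n} \<subseteq> T"
    using g(2) xy(1) by (auto simp: less_Suc_eq adj_rel_def)
  moreover have "parent_fun (Suc n) (p(n := j))"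
    using p j by (auto simp: parent_fun_def less_Suc_eq)
  moreover have "{(g(n := y)) i, (g(n := y)) ((p(n := j)) i)} \<in> F" if "0 < i" "i < Suc n" for i
  proof (cases "i = n")
    case True
    then show ?thesis using xy(1) j by (auto simp: adj_rel_def insert_commute)
  next
    case False
    then have "i < n" using that by simp
    moreover then have "p i < i" using p that unfolding parent_fun_def by blast
    ultimately show ?thesis using e that by auto
  qed
  ultimately show ?case by blast
qed

text \<open>Growing a connected set gives a spanning tree with smaller parents. Acyclicity then
  excludes all further edges.\<close>

lemma tree_enumeration:
  assumes "is_tree T F"
  shows "\<exists>m g p. 0 < m \<and> parent_fun m p \<and> bij_betw g {..<m} T \<and>
           (\<forall>f\<in>F. \<exists>i. 0 < i \<and> i < m \<and> f = {g i, g (p i)})"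
proof -
  have sg: "sgraph T F" and ne: "T \<noteq> {}" and conn: "sconnected T F"
    and ac: "\<not> has_cycle T F" using assms unfolding is_tree_def by auto
  have fin: "finite T" using sg unfolding sgraph_def by auto
  define m where "m = card T"
  have m: "0 < m" using fin ne unfolding m_def by (simp add: card_gt_0_iff)
  obtain g p where g: "inj_on g {..<m}" "g ` {..<m} \<subseteq> T" and p: "parent_fun m p"
    and e: "\<And>i. 0 < i \<Longrightarrow> i < m \<Longrightarrow> {g i, g (p i)} \<in> F"
    using connected_enumeration[OF fin conn m] unfolding m_def by auto
  have im: "g ` {..<m} = T" using g fin by (simp add: card_image card_subset_eq m_def)
  have step: "j = p i" if ij: "j < i" "i < m" "{g i, g j} \<in> F" for i j
  proof (rule ccontr)
    \<comment> \<open>Close the path from \<open>j\<close> to \<open>p i\<close> through earlier nodes to a cycle through \<open>i\<close>.\<close>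
    assume "j \<noteq> p i"
    have i: "0 < i" "p i < i" using ij p unfolding parent_fun_def by auto
    have pi: "parent_fun i p" using p ij unfolding parent_fun_def by auto
    have "sconnected {..<i} (parent_edges i p)"
      using parent_edges_tree[OF i(1) pi] unfolding is_tree_def by blast
    then obtain xs where xs: "is_path {..<i} (parent_edges i p) xs" "hd xs = j" "last xs = p i"
      unfolding sconnected_def using ij i by (meson lessThan_iff)
    have ne: "xs \<noteq> []" and sub: "set xs \<subseteq> {..<i}" and d: "distinct xs"
      and E: "\<And>s. Suc s < length xs \<Longrightarrow> {xs ! s, xs ! Suc s} \<in> parent_edges i p"
      using xs(1) unfolding is_path_def by auto
    have inj: "inj_on g (insert i (set xs))"
      using g(1) sub ij by (rule_tac inj_on_subset[of g "{..<m}"]) auto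
    have len: "2 \<le> length xs"
    proof -
      obtain a b where "xs = a # b" using ne by (cases xs) auto
      then show ?thesis using xs(2,3) \<open>j \<noteq> p i\<close> by (cases b) auto
    qed
    have "{map g xs ! s, map g xs ! Suc s} \<in> F" if s: "Suc s < length (map g xs)" for s
    proof -
      obtain q where "{xs ! s, xs ! Suc s} = {q, p q}" "0 < q" "q < i"
        using E[of s] s unfolding parent_edges_def length_map by blast
      moreover then have "{g (xs ! s), g (xs ! Suc s)} = {g q, g (p q)}"
        by (metis image_empty image_insert)
      ultimately show ?thesis using e[of q] s ij(2) by simp
    qed
    moreover have "set (map g xs) \<subseteq> T" using sub im ij by fastforce
    moreover have "distinct (map g xs)" using d inj by (simp add: distinct_map)
    ultimately have P: "is_path T F (map g xs)" using ne unfolding is_path_def by auto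
    have "g i \<notin> set (map g xs)" using inj sub by (auto simp: inj_on_def)
    moreover have "g i \<in> T" using im ij by blast
    moreover obtain a b where ab: "xs = a # b" using ne by (cases xs) auto
    ultimately have "is_path T F (g i # map g xs)"
      using P ij xs(2) by (simp add: is_path_Cons)
    moreover have "{last (g i # map g xs), hd (g i # map g xs)} \<in> F"
      using e[OF i(1) ij(2)] xs(3) ne by (simp add: last_map insert_commute)
    ultimately show False using ac len unfolding has_cycle_def
      by (metis One_nat_def Suc_1 Suc_le_mono length_Cons length_map numeral_3_eq_3)
  qed
  have "\<exists>i. 0 < i \<and> i < m \<and> f = {g i, g (p i)}" if f: "f \<in> F" for f
  proof -
    obtain u v where uv: "f = {u, v}" "u \<noteq> v" "u \<in> T" "v \<in> T"
      using f sg unfolding sgraph_def by blast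
    then obtain i j where ij: "u = g i" "v = g j" "i < m" "j < m" using im by blast
    consider "j < i" | "i < j" using uv ij by (metis linorder_less_linear)
    then show ?thesis
    proof cases
      case 1
      then show ?thesis using step[of j i] f uv ij by (intro exI[of _ i]) auto
    next
      case 2
      then show ?thesis using step[of i j] f uv ij by (intro exI[of _ j]) (auto simp: insert_commute)
    qed
  qed
  then show ?thesis using m p g(1) im unfolding bij_betw_def by blast
qed

lemma rooted_if_treewidth_le:
  assumes "treewidth_le V E w"
  shows "\<exists>m p B r. rooted_decomposition V E m p B r \<and> (\<forall>i<m. card (B i) \<le> w + 1)"
proof -
  obtain T F B where D: "tree_decomposition V E T F B" and w: "\<forall>x\<in>T. card (B x) \<le> w + 1"
    using assms unfolding treewidth_le_def by blast
  then obtain m g p where m: "0 < m" and p: "parent_fun m p" and g: "bij_betw g {..<m} T"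
    and F: "\<And>f. f \<in> F \<Longrightarrow> \<exists>i. 0 < i \<and> i < m \<and> f = {g i, g (p i)}"
    using tree_enumeration unfolding tree_decomposition_def by metis
  have im: "g ` {..<m} = T" and inj: "\<And>i j. i < m \<Longrightarrow> j < m \<Longrightarrow> g i = g j \<longleftrightarrow> i = j"
    using g by (auto simp: bij_betw_def inj_on_def)
  define r where "r v = (LEAST i. i < m \<and> v \<in> B (g i))" for v
  have r: "r v < m \<and> v \<in> B (g (r v))" if "v \<in> V" for v
  proof -
    obtain x where "x \<in> T" "v \<in> B x" using D \<open>v \<in> V\<close> unfolding tree_decomposition_def by blast
    then obtain i where "i < m \<and> v \<in> B (g i)" using im by blast
    then show ?thesis unfolding r_def by (rule LeastI)
  qed
  have par: "r v < i \<and> v \<in> B (g (p i))" if v: "v \<in> V" "i < m" "v \<in> B (g i)" "i \<noteq> r v" for v i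
  proof -
    have ri: "r v < i" using v Least_le[of "\<lambda>i. i < m \<and> v \<in> B (g i)" i] unfolding r_def by simp
    \<comment> \<open>The only tree edge leaving the set of descendants of \<open>i\<close> is the one from \<open>i\<close> to \<open>p i\<close>.\<close>
    define R where "R = {(j, p j) | j. 0 < j \<and> j < m}"
    define C where "C = {j. j < m \<and> (j, i) \<in> R\<^sup>*}"
    have desc: "i \<le> j" if "(j, i) \<in> R\<^sup>*" for j
      using that
    proof (induction rule: converse_rtrancl_induct)
      case (step y z)
      then show ?case using p unfolding R_def parent_fun_def by auto
    qed simp
    \<comment> \<open>Descendants of \<open>i\<close> have numbers at least \<open>i\<close>, while
      \<open>r v < i\<close>. So connectivity of the nodes of \<open>v\<close> forces an edge
      between them that leaves \<open>C\<close>.\<close>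
    have "r v \<notin> C" using ri desc[of "r v"] unfolding C_def by auto
    then have out: "g (r v) \<notin> g ` C" using inj r v unfolding C_def by auto
    have "i \<in> C" using v unfolding C_def by simp
    then have "g i \<in> g ` C" by simp
    define Q where "Q = adj_rel {x\<in>T. v \<in> B x} {f\<in>F. f \<subseteq> {x\<in>T. v \<in> B x}}"
    have "(g i, g (r v)) \<in> Q\<^sup>*"
      using D v r[of v] im unfolding tree_decomposition_def sconnected_iff Q_def by auto
    from rtrancl_crossing[OF this \<open>g i \<in> g ` C\<close> out]
    obtain x y where "(x, y) \<in> Q" "x \<in> g ` C" "y \<notin> g ` C" by blast
    then have xy: "{x, y} \<in> F" "v \<in> B y" "x \<in> g ` C" "y \<in> T" "y \<notin> g ` C"
      unfolding Q_def adj_rel_def by simp_all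
    then obtain j where j: "x = g j" "j < m" "(j, i) \<in> R\<^sup>*" unfolding C_def by auto
    obtain j' where j': "y = g j'" "j' < m" using xy im by blast
    then have "j' \<notin> C" using xy by blast
    then have jC: "(j', i) \<notin> R\<^sup>*" using j' unfolding C_def by simp
    obtain s where s: "0 < s" "s < m" "{g j, g j'} = {g s, g (p s)}" 
      using F[OF xy(1)] j(1) j'(1) by blast
    have "p s < m" using s p unfolding parent_fun_def by fastforce
    then have "j = s \<and> j' = p s \<or> j = p s \<and> j' = s"
      using s j(2) j'(2) inj[of j s] inj[of j' s] inj[of j "p s"] inj[of j' "p s"]
      by (simp add: doubleton_eq_iff)
    \<comment> \<open>If the crossing edge goes up from \<open>j\<close>, then \<open>j = i\<close>,
      as otherwise the parent of \<open>j\<close> would still be a descendant of \<open>i\<close>.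
      If it goes down from \<open>j\<close>, its lower end would be a descendant of
      \<open>i\<close>.\<close>
    then have "v \<in> B (g (p i))"
    proof (elim disjE conjE)
      assume js: "j = s" "j' = p s"
      have "j = i"
      proof (rule ccontr)
        assume "j \<noteq> i"
        then obtain z where "(j, z) \<in> R" "(z, i) \<in> R\<^sup>*" using j(3) by (meson converse_rtranclE)
        then show False using jC js unfolding R_def by auto
      qed
      then show ?thesis using js xy j' by simp
    next
      assume js: "j = p s" "j' = s"
      then have "(j', j) \<in> R" using s unfolding R_def by auto
      then show ?thesis using jC j(3) by (meson converse_rtrancl_into_rtrancl)
    qed
    then show ?thesis using ri by simp
  qed
  have "\<exists>i<m. e \<subseteq> B (g i)" if "e \<in> E" for e
  proof -
    obtain x where "x \<in> T" "e \<subseteq> B x" using D \<open>e \<in> E\<close> unfolding tree_decomposition_def by blast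
    then show ?thesis using im by blast
  qed
  moreover have "B (g i) \<subseteq> V" if "i < m" for i
  proof -
    have "g i \<in> T" using im that by blast
    then show ?thesis using D unfolding tree_decomposition_def by blast
  qed
  ultimately have "rooted_decomposition V E m p (\<lambda>i. B (g i)) r"
    unfolding rooted_decomposition_def using m p r par by blast
  moreover have "card (B (g i)) \<le> w + 1" if "i < m" for i
  proof -
    have "g i \<in> T" using im that by blast
    then show ?thesis using w by blast
  qed
  ultimately show ?thesis by (intro exI conjI allI impI)
qed

section \<open>Upward reachability in elimination orderings\<close>

text \<open>The bag \<open>U i\<close> consists of \<open>i\<close> and its earlier neighbours in a chordal supergraph of \<open>H\<close>
  with perfect elimination ordering given by the natural numbers. Reachability by steps into these
  bags then is the ancestor relation of a forest.\<close>

locale elimination =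
  fixes U :: "nat \<Rightarrow> nat set"
  assumes self: "i \<in> U i"
    and le: "a \<in> U i \<Longrightarrow> a \<le> i"
    and clique: "a \<in> U i \<Longrightarrow> b \<in> U i \<Longrightarrow> a \<le> b \<Longrightarrow> a \<in> U b"

text \<open>In an \<open>elimination\<close>, \<open>i\<close> lies in \<open>U i\<close>, so idle
  steps are allowed and \<open>k\<close> steps mean at most \<open>k\<close> steps.\<close>

primrec up_reach :: "(nat \<Rightarrow> nat set) \<Rightarrow> nat \<Rightarrow> nat \<Rightarrow> nat set" where
  "up_reach U 0 i = {i}"
| "up_reach U (Suc k) i = (\<Union>j\<in>U i. up_reach U k j)"

context elimination
begin

lemma finite_bag: "finite (U i)"
  using le by (meson finite_nat_set_iff_bounded_le)

lemma up_reach_le: "y \<in> up_reach U k x \<Longrightarrow> y \<le> x"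
  by (induction k arbitrary: x) (auto dest: le intro: order_trans)

lemma finite_up_reach: "finite (up_reach U k x)"
  using up_reach_le by (meson finite_nat_set_iff_bounded_le)

lemma up_reach_Suc_mono: "y \<in> up_reach U k x \<Longrightarrow> y \<in> up_reach U (Suc k) x"
  by (induction k arbitrary: x) (use self in auto)

lemma up_reach_mono: "k \<le> k' \<Longrightarrow> y \<in> up_reach U k x \<Longrightarrow> y \<in> up_reach U k' x"
  by (induction k' rule: dec_induct) (use up_reach_Suc_mono in blast)+

lemma self_up_reach: "x \<in> up_reach U k x"
  using up_reach_mono[of 0 k x x] by simp

lemma up_reach_into_bag: "z \<in> up_reach U m x \<Longrightarrow> b \<in> U z \<Longrightarrow> b \<in> up_reach U (Suc m) x"
proof (induction m arbitrary: x)
  case (Suc m)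
  then obtain j where "j \<in> U x" "z \<in> up_reach U m j" by auto
  then have "j \<in> U x" "b \<in> up_reach U (Suc m) j" using Suc by auto
  then show ?case by (subst up_reach.simps) blast
qed simp

text \<open>All vertices on the way from \<open>x\<close> to \<open>z\<close> are at least
  \<open>z\<close>, hence at least \<open>y\<close>; so \<open>clique\<close> hands \<open>y\<close>
  from each bag to the next.\<close>

lemma bag_between: "y \<in> U x \<Longrightarrow> z \<in> up_reach U m x \<Longrightarrow> y \<le> z \<Longrightarrow> y \<in> U z"
proof (induction m arbitrary: x)
  case (Suc m)
  then obtain j where j: "j \<in> U x" "z \<in> up_reach U m j" by auto
  then have "y \<in> U j" using Suc.prems up_reach_le[of z m j] clique by (meson order_trans)
  then show ?case using Suc.IH j Suc.prems by blast
qed simp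

text \<open>The first step \<open>l\<close> and \<open>j\<close> lie in the common bag
  \<open>U x\<close>, so one is in the bag of the other. Either \<open>j\<close> can step to
  \<open>l\<close> itself, or \<open>j\<close> is in the bag of \<open>l\<close> and induction
  applies.\<close>

lemma up_reach_via_bag: "j \<in> U x \<Longrightarrow> z \<in> up_reach U m x \<Longrightarrow> z \<le> j \<Longrightarrow> z \<in> up_reach U m j"
proof (induction m arbitrary: x)
  case 0
  then show ?case using le[of j x] by simp
next
  case (Suc m)
  then obtain l where l: "l \<in> U x" "z \<in> up_reach U m l" by auto
  show ?case
  proof (cases "l \<le> j")
    case True
    then have "l \<in> U j" using clique l Suc.prems by blast
    then show ?thesis using l by auto
  next
    case False
    then have "j \<in> U l" using clique[of j x l] l Suc.prems by simp
    then show ?thesis using Suc.IH l Suc.prems up_reach_Suc_mono by blast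
  qed
qed

text \<open>Let \<open>j\<close> be the first step towards \<open>y\<close>. If
  \<open>j \<le> z\<close>, then \<open>z\<close> can take that step itself; otherwise
  \<open>z\<close> is also reached from \<open>j\<close>, and induction applies with one step
  less.\<close>

lemma up_reach_between:
  "y \<in> up_reach U k x \<Longrightarrow> z \<in> up_reach U m x \<Longrightarrow> y \<le> z \<Longrightarrow> y \<in> up_reach U k z"
proof (induction k arbitrary: x)
  case 0
  then show ?case using up_reach_le[of z m x] by simp
next
  case (Suc k)
  then obtain j where j: "j \<in> U x" "y \<in> up_reach U k j" by auto
  show ?case
  proof (cases "j \<le> z")
    case True
    then have "j \<in> U z" using bag_between j Suc.prems by blast
    then show ?thesis using j by auto
  next
    case False
    then have "z \<in> up_reach U m j" using up_reach_via_bag[of j x z m] j Suc.prems by simp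
    then show ?thesis using Suc.IH j Suc.prems up_reach_Suc_mono by blast
  qed
qed

text \<open>A step to an earlier vertex is a step of \<open>up_reach\<close>. A step to a later
  vertex can be skipped by \<open>up_reach_via_bag\<close>, because the walk never goes before
  \<open>y\<close>.\<close>

lemma up_reach_walk:
  assumes "\<And>i. i < j \<Longrightarrow> f i \<in> U (f (Suc i)) \<or> f (Suc i) \<in> U (f i)"
    and "\<And>i. i < j \<Longrightarrow> y \<le> f i" and "y \<in> up_reach U m (f j)"
  shows "y \<in> up_reach U (m + j) (f 0)"
  using assms
proof (induction j arbitrary: f)
  case (Suc j)
  have IH: "y \<in> up_reach U (m + j) (f 1)"
    using Suc.IH[of "\<lambda>i. f (Suc i)", OF Suc.prems(1) Suc.prems(2) Suc.prems(3)] by simp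
  have "f 0 \<in> U (f (Suc 0)) \<or> f (Suc 0) \<in> U (f 0)" by (rule Suc.prems(1)) simp
  then show ?case
  proof
    assume "f 0 \<in> U (f (Suc 0))"
    then have "y \<in> up_reach U (m + j) (f 0)"
      using up_reach_via_bag[of "f 0" "f 1" y "m + j"] IH Suc.prems(2)[of 0] by simp
    then show ?thesis using up_reach_Suc_mono by simp
  next
    assume "f (Suc 0) \<in> U (f 0)"
    then show ?thesis using IH by auto
  qed
qed simp

lemma up_reach_nonself:
  "y \<in> up_reach U k x \<Longrightarrow> y \<noteq> x \<Longrightarrow> \<exists>j\<in>U x. j \<noteq> x \<and> y \<in> up_reach U k j"
proof (induction k)
  case (Suc k)
  then obtain j where j: "j \<in> U x" "y \<in> up_reach U k j" by auto
  show ?case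
  proof (cases "j = x")
    case True
    then show ?thesis using Suc j up_reach_Suc_mono by blast
  next
    case False
    then show ?thesis using j up_reach_Suc_mono by blast
  qed
qed simp

end

text \<open>Let \<open>y\<^sub>1\<close> be the first element of \<open>U x\<close>. What is reached in \<open>k + 1\<close> steps at or before
  \<open>y\<^sub>1\<close> is reached in \<open>k\<close> steps from \<open>y\<^sub>1\<close>, and what is reached after \<open>y\<^sub>1\<close> is reached
  within bags that lose the element \<open>y\<^sub>1\<close>. This is Pascal's recursion.\<close>

lemma card_up_reach:
  assumes "elimination U" and "\<And>i. card (U i) \<le> t + 1"
  shows "card (up_reach U k x) \<le> (k + t choose t)"
  using assms
proof (induction t arbitrary: U k x)
  case 0
  interpret elimination U by fact
  have "U i = {i}" for i
    using 0(2)[of i] self[of i] finite_bag[of i] card_le_Suc0_iff_eq[of "U i"] by auto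
  then have "up_reach U k x = {x}" by (induction k arbitrary: x) auto
  then show ?case by simp
next
  case (Suc t)
  note IH = Suc.IH and bound = Suc.prems(2)
  interpret elimination U by fact
  show ?case
  proof (induction k arbitrary: x)
    case (Suc k)
    define y1 where "y1 = Min (U x)"
    have y1: "y1 \<in> U x" using self[of x] finite_bag[of x] Min_in unfolding y1_def by blast
    have min: "y1 \<le> j" if "j \<in> U x" for j using that finite_bag unfolding y1_def by simp
    \<comment> \<open>Vertices after \<open>y1\<close> that are reached from \<open>x\<close> have
      \<open>y1\<close> in their bag, so there the removal lowers the bag size. All other bags of
      \<open>W\<close> become singletons, so that \<open>W\<close> satisfies the locale and the size
      bound on all naturals.\<close>
    define good where "good j \<longleftrightarrow> y1 < j \<and> (\<exists>m. j \<in> up_reach U m x)" for j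
    define W where "W j = (if good j then U j - {..y1} else {j})" for j
    have good_step: "good b" if "good i" "b \<in> U i" "y1 < b" for i b
    proof -
      obtain m where "i \<in> up_reach U m x" using \<open>good i\<close> unfolding good_def by blast
      then have "b \<in> up_reach U (Suc m) x" using \<open>b \<in> U i\<close> by (rule up_reach_into_bag)
      then show ?thesis using \<open>y1 < b\<close> unfolding good_def by blast
    qed
    have W: "elimination W"
    proof
      show "i \<in> W i" for i using self unfolding W_def good_def by auto
      show "a \<in> W i \<Longrightarrow> a \<le> i" for a i using le unfolding W_def by (auto split: if_splits)
      show "a \<in> W b" if "a \<in> W i" "b \<in> W i" "a \<le> b" for a b i
      proof (cases "good i")
        case True
        then have ab: "a \<in> U i" "b \<in> U i" "y1 < a" "y1 < b" using that unfolding W_def by auto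
        then have "a \<in> U b" "good b"
          using clique[of a i b] good_step[of i b] True \<open>a \<le> b\<close> by auto
        then show ?thesis using ab unfolding W_def by auto
      next
        case False
        then show ?thesis using that unfolding W_def by auto
      qed
    qed
    have "card (W j) \<le> t + 1" for j
    proof (cases "good j")
      case True
      then have "y1 \<in> U j" using bag_between y1 unfolding good_def by (meson less_imp_le)
      then have "W j \<subseteq> U j - {y1}" using True unfolding W_def by auto
      then have "card (W j) \<le> card (U j - {y1})" using finite_bag by (intro card_mono) auto
      also have "\<dots> \<le> t + 1" using bound[of j] \<open>y1 \<in> U j\<close> by simp
      finally show ?thesis .
    qed (simp add: W_def)
    then have cW: "card (up_reach W (Suc k) x) \<le> (Suc k + t choose t)"
      using IH W by blast
    have low: "y \<in> up_reach U k y1" if y: "y \<in> up_reach U (Suc k) x" "y \<le> y1" for y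
    proof -
      obtain j where j: "j \<in> U x" "y \<in> up_reach U k j" using y(1) by auto
      \<comment> \<open>As the minimum of \<open>U x\<close>, \<open>y1\<close> lies in the bag of
        every first step \<open>j\<close>.\<close>
      then have "y1 \<in> U j" using min clique y1 by blast
      then show ?thesis using up_reach_via_bag j y(2) by blast
    qed
    have high: "y \<in> up_reach W m z" if "y \<in> up_reach U m z" "y1 < y" "good z" for y m z
      using that
    proof (induction m arbitrary: z)
      case (Suc m)
      then obtain j where j: "j \<in> U z" "y \<in> up_reach U m j" by auto
      then have "y1 < j" using Suc.prems up_reach_le by (meson less_le_trans)
      then have "good j" "j \<in> W z" using j Suc.prems good_step unfolding W_def by auto
      then show ?case using Suc j by auto
    qed simp
    have "up_reach U (Suc k) x \<subseteq> up_reach U k y1 \<union> up_reach W (Suc k) x"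
    proof
      fix y assume y: "y \<in> up_reach U (Suc k) x"
      show "y \<in> up_reach U k y1 \<union> up_reach W (Suc k) x"
      proof (cases "y \<le> y1")
        case True
        then show ?thesis using low y by blast
      next
        case False
        then have "y1 < x" using up_reach_le[OF y] by simp
        then have "good x" using self_up_reach unfolding good_def by blast
        then show ?thesis using high[OF y] False by simp
      qed
    qed
    then have "card (up_reach U (Suc k) x) \<le> card (up_reach U k y1 \<union> up_reach W (Suc k) x)"
      using finite_up_reach elimination.finite_up_reach[OF W] by (intro card_mono finite_UnI)
    also have "\<dots> \<le> card (up_reach U k y1) + card (up_reach W (Suc k) x)"
      by (rule card_Un_le)
    also have "\<dots> \<le> (k + Suc t choose Suc t) + (Suc k + t choose t)"
      using Suc.IH cW by (rule add_mono)
    also have "\<dots> = (Suc k + Suc t choose Suc t)" by simp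
    finally show ?case .
  qed simp
qed

section \<open>Treewidth and elimination orderings\<close>

text \<open>Ascending from \<open>i\<close> to \<open>r b\<close> keeps \<open>b\<close> in the bag.
  It keeps \<open>a\<close> as well, since every node left on the way has a number above
  \<open>r b\<close> and hence differs from \<open>r a\<close>.\<close>

lemma rooted_bag_at_root:
  assumes D: "rooted_decomposition V E m p B r" and ab: "a \<in> V" "b \<in> V" and ra: "r a \<le> r b"
    and "i < m" "a \<in> B i" "b \<in> B i"
  shows "a \<in> B (r b)"
  using \<open>i < m\<close> \<open>a \<in> B i\<close> \<open>b \<in> B i\<close>
proof (induction i rule: less_induct)
  case (less i)
  have R: "j < m \<Longrightarrow> v \<in> B j \<Longrightarrow> j \<noteq> r v \<Longrightarrow> r v < j \<and> v \<in> B (p j)" if "v \<in> V" for v j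
    using D that unfolding rooted_decomposition_def by blast
  show ?case
  proof (cases "i = r b")
    case False
    then have b: "r b < i" "b \<in> B (p i)" using R[OF ab(2) less.prems(1,3)] by auto
    then have "a \<in> B (p i)" using R[OF ab(1) less.prems(1,2)] ra by auto
    moreover have "p i < i"
      using D b less.prems(1) unfolding rooted_decomposition_def parent_fun_def by auto
    ultimately show ?thesis using less.IH[of "p i"] less.prems b by simp
  qed (use less.prems in simp)
qed

text \<open>The vertices are sorted by topmost node, and \<open>U\<close> collects the earlier
  vertices of the topmost bag. This amounts to turning all bags into cliques, which gives a chordal
  supergraph.\<close>

lemma elimination_if_treewidth_le:
  assumes fin: "finite V" and "treewidth_le V E t"
  shows "\<exists>\<nu> U. elimination U \<and> (\<forall>i. card (U i) \<le> t + 1) \<and> inj_on \<nu> V \<and>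
           (\<forall>u\<in>V. \<forall>v\<in>V. {u, v} \<in> E \<longrightarrow> \<nu> u \<in> U (\<nu> v) \<or> \<nu> v \<in> U (\<nu> u))"
proof -
  obtain m p B r where D: "rooted_decomposition V E m p B r"
    and w: "\<And>i. i < m \<Longrightarrow> card (B i) \<le> t + 1"
    using rooted_if_treewidth_le[OF assms(2)] by blast
  have r: "r v < m" "v \<in> B (r v)" if "v \<in> V" for v
    using D that unfolding rooted_decomposition_def by auto
  have BV: "B i \<subseteq> V" if "i < m" for i
    using D that unfolding rooted_decomposition_def by auto
  obtain h and n :: nat where h: "h ` V = {i. i < n}" "inj_on h V"
    using finite_imp_inj_to_nat_seg[OF fin] by blast
  \<comment> \<open>Since \<open>h v < n\<close>, this is the lexicographic order by
    \<open>r v\<close> and then \<open>h v\<close>; quotient and remainder by \<open>n\<close>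
    recover both.\<close>
  define \<nu> where "\<nu> v = r v * n + h v" for v
  have hn: "h v < n" if "v \<in> V" for v using h(1) that by blast
  have mono: "r a \<le> r b" if ab: "a \<in> V" "b \<in> V" "\<nu> a \<le> \<nu> b" for a b
  proof -
    have "\<nu> v div n = r v" if "v \<in> V" for v using hn[OF that] unfolding \<nu>_def by simp
    then show ?thesis using div_le_mono[OF ab(3), of n] ab by simp
  qed
  have inj: "inj_on \<nu> V"
  proof (rule inj_onI)
    fix a b assume ab: "a \<in> V" "b \<in> V" "\<nu> a = \<nu> b"
    have "\<nu> v mod n = h v" if "v \<in> V" for v using hn[OF that] unfolding \<nu>_def by simp
    then have "h a = h b" using ab by metis
    then show "a = b" using h(2) ab by (simp add: inj_on_eq_iff)
  qed
  \<comment> \<open>Numbers that name no vertex get singleton bags, because the locale speaks of all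
    naturals.\<close>
  define U where "U i = (if i \<in> \<nu> ` V
    then \<nu> ` {u \<in> B (r (inv_into V \<nu> i)). \<nu> u \<le> i} else {i})" for i
  have U: "U (\<nu> v) = \<nu> ` {u \<in> B (r v). \<nu> u \<le> \<nu> v}" if "v \<in> V" for v
    using that inj unfolding U_def by simp
  have U': "U i = {i}" if "i \<notin> \<nu> ` V" for i using that unfolding U_def by simp
  have bag: "\<nu> a \<in> U (\<nu> b)" if "a \<in> V" "b \<in> V" "\<nu> a \<le> \<nu> b" "i < m" "a \<in> B i" "b \<in> B i" for a b i
    using rooted_bag_at_root[OF D, of a b i] mono[of a b] U[of b] that by blast
  have el: "elimination U"
  proof
    show "i \<in> U i" for i
      by (cases "i \<in> \<nu> ` V") (use U U' r in auto)
    show "a \<le> i" if "a \<in> U i" for a i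
      by (cases "i \<in> \<nu> ` V") (use U U' that in auto)
    show "a \<in> U b" if ab: "a \<in> U i" "b \<in> U i" "a \<le> b" for a b i
    proof (cases "i \<in> \<nu> ` V")
      case True
      then obtain v where v: "v \<in> V" "i = \<nu> v" by blast
      then obtain a' b' where "a = \<nu> a'" "b = \<nu> b'" "a' \<in> B (r v)" "b' \<in> B (r v)"
        using ab U by auto
      then show ?thesis using bag[of a' b' "r v"] r v BV ab(3) by blast
    next
      case False
      then show ?thesis using ab U' by auto
    qed
  qed
  have "card (U i) \<le> t + 1" for i
  proof (cases "i \<in> \<nu> ` V")
    case True
    then obtain v where v: "v \<in> V" "i = \<nu> v" by blast
    have fB: "finite (B (r v))" using BV[of "r v"] r v fin finite_subset by blast
    have "card (U i) \<le> card {u \<in> B (r v). \<nu> u \<le> \<nu> v}"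
      using fB U[OF v(1)] v(2) by (simp add: card_image_le)
    also have "\<dots> \<le> card (B (r v))" using fB by (intro card_mono) auto
    finally show ?thesis using w[of "r v"] r v by simp
  qed (simp add: U')
  moreover have "\<nu> u \<in> U (\<nu> v) \<or> \<nu> v \<in> U (\<nu> u)" if uv: "u \<in> V" "v \<in> V" "{u, v} \<in> E" for u v
  proof -
    obtain i where "i < m" "{u, v} \<subseteq> B i"
      using D uv(3) unfolding rooted_decomposition_def by blast
    then show ?thesis using bag[of u v i] bag[of v u i] uv by (meson insert_subset nle_le)
  qed
  ultimately show ?thesis using el inj by blast
qed

text \<open>Node \<open>Suc j\<close> carries what \<open>j\<close> reaches, and its parent belongs
  to the latest element of \<open>U j\<close> other than \<open>j\<close>. Node 0 is an extra root
  with empty bag that joins the trees of the ancestor forest.\<close>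

lemma treewidth_le_if_up_reach:
  assumes el: "elimination U" and c: "\<And>i. card (up_reach U k i) \<le> w + 1"
    and VJ: "VJ \<subseteq> {..<M}"
    and EJ: "\<And>e. e \<in> EJ \<Longrightarrow> e \<subseteq> VJ \<and> (\<exists>x<M. e \<subseteq> up_reach U k x)"
  shows "treewidth_le VJ EJ w"
proof -
  interpret elimination U by fact
  define p where "p i = (case i of 0 \<Rightarrow> 0 |
    Suc j \<Rightarrow> if U j = {j} then 0 else Suc (Max (U j - {j})))" for i
  define B where "B i = (case i of 0 \<Rightarrow> {} | Suc j \<Rightarrow> up_reach U k j \<inter> VJ)" for i
  have mx: "Max (U j - {j}) \<in> U j - {j}" if "U j \<noteq> {j}" for j
    using that self finite_bag by (intro Max_in) auto
  have "parent_fun (Suc M) p"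
    unfolding parent_fun_def
  proof (intro allI impI)
    fix i assume "0 < i \<and> i < Suc M"
    then obtain j where j: "i = Suc j" by (cases i) auto
    show "p i < i"
    proof (cases "U j = {j}")
      case False
      then have "Max (U j - {j}) < j" using mx[OF False] le by (metis DiffE insertI1 nat_less_le)
      then show ?thesis using j False unfolding p_def by simp
    qed (simp add: p_def j)
  qed
  moreover have "B i \<subseteq> VJ" for i unfolding B_def by (cases i) auto
  moreover have "\<exists>i<Suc M. e \<subseteq> B i" if e: "e \<in> EJ" for e
  proof -
    obtain x where "x < M" "e \<subseteq> up_reach U k x" "e \<subseteq> VJ" using EJ[OF e] by blast
    then show ?thesis unfolding B_def by (intro exI[of _ "Suc x"]) simp
  qed
  moreover have "Suc v < Suc M" "v \<in> B (Suc v)" if "v \<in> VJ" for v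
    using VJ that self_up_reach unfolding B_def by auto
  moreover have "Suc v < i \<and> v \<in> B (p i)" if v: "v \<in> B i" "i \<noteq> Suc v" for v i
  proof -
    obtain j where j: "i = Suc j" "v \<in> up_reach U k j" "v \<in> VJ" "v \<noteq> j"
      using v unfolding B_def by (cases i) auto
    obtain l where l: "l \<in> U j" "l \<noteq> j" "v \<in> up_reach U k l"
      using up_reach_nonself[OF j(2,4)] by blast
    then have ne: "U j \<noteq> {j}" by blast
    define q where "q = Max (U j - {j})"
    have q: "q \<in> U j" using mx[OF ne] unfolding q_def by blast
    \<comment> \<open>A step \<open>l\<close> on the way to \<open>v\<close> gives
      \<open>v \<le> q\<close>, so \<open>v\<close> is reached from \<open>q\<close> in as many
      steps as from \<open>j\<close>.\<close>
    have "l \<le> q" using l finite_bag unfolding q_def by simp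
    then have "v \<le> q" using up_reach_le[OF l(3)] by simp
    then have "v \<in> up_reach U k q" using up_reach_via_bag[OF q j(2)] by simp
    moreover have "p i = Suc q" using j ne unfolding p_def q_def by simp
    moreover have "v < j" using up_reach_le[OF j(2)] j(4) by simp
    ultimately show ?thesis using j unfolding B_def by simp
  qed
  ultimately have "rooted_decomposition VJ EJ (Suc M) p B Suc"
    unfolding rooted_decomposition_def by blast
  moreover have "card (B i) \<le> w + 1" for i
  proof (cases i)
    case (Suc j)
    have "card (up_reach U k j \<inter> VJ) \<le> card (up_reach U k j)"
      using finite_up_reach by (intro card_mono) auto
    then show ?thesis using c[of j] Suc unfolding B_def by simp
  qed (simp add: B_def)
  ultimately show ?thesis by (rule treewidth_le_if_rooted)
qed

section \<open>Shortcut systems\<close>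

lemma mem_internal_vertices_iff:
  "u \<in> internal_vertices q \<longleftrightarrow> (\<exists>j. 0 < j \<and> Suc j < length q \<and> u = q ! j)"
proof
  assume "u \<in> internal_vertices q"
  then obtain i where i: "i < length (butlast (tl q))" "butlast (tl q) ! i = u"
    unfolding internal_vertices_def in_set_conv_nth by blast
  then have "u = q ! Suc i" by (simp add: nth_butlast nth_tl)
  then show "\<exists>j. 0 < j \<and> Suc j < length q \<and> u = q ! j"
    using i by (intro exI[of _ "Suc i"]) simp
next
  assume "\<exists>j. 0 < j \<and> Suc j < length q \<and> u = q ! j"
  then obtain i where i: "Suc (Suc i) < length q" "u = q ! Suc i"
    by (metis not0_implies_Suc less_not_refl)
  then have "i < length (butlast (tl q))" "butlast (tl q) ! i = u"
    by (simp_all add: nth_butlast nth_tl)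
  then show "u \<in> internal_vertices q" unfolding internal_vertices_def in_set_conv_nth by blast
qed

text \<open>Here \<open>x v\<close> is the part containing \<open>v\<close>, and \<open>top v\<close> is the part that \<open>v\<close> is moved to. The
  endpoints of paths are left out of \<open>parts v\<close> because a vertex can be an endpoint of
  arbitrarily many paths.\<close>

locale shortcut_parts = elimination U for U +
  fixes V :: "'a set" and E :: "'a set set" and P :: "'a list set" and k :: nat and x :: "'a \<Rightarrow> nat"
  assumes fin: "finite V"
    and kpos: "0 < k"
    and adj: "u \<in> V \<Longrightarrow> v \<in> V \<Longrightarrow> {u, v} \<in> E \<Longrightarrow> x u \<in> U (x v) \<or> x v \<in> U (x u)"
    and paths: "q \<in> P \<Longrightarrow> is_path V E q \<and> 2 \<le> length q \<and> length q - 1 \<le> k"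
begin

section \<open>Reaching the new part of a vertex from old parts\<close>

definition parts :: "'a \<Rightarrow> nat set" where
  "parts v = {x v} \<union> {x u | u q. q \<in> P \<and> v \<in> set q \<and> u \<in> internal_vertices q}"

definition top :: "'a \<Rightarrow> nat" where
  "top v = Min (parts v)"

lemma path_nth:
  assumes "q \<in> P" and "i < length q"
  shows "q ! i \<in> V"
  using paths[OF assms(1)] assms(2) nth_mem unfolding is_path_def by blast

lemma path_edge:
  assumes "q \<in> P" and "Suc i < length q"
  shows "{q ! i, q ! Suc i} \<in> E"
  using paths[OF assms(1)] assms(2) unfolding is_path_def by blast

lemma parts_subset: "v \<in> V \<Longrightarrow> parts v \<subseteq> x ` V"
  unfolding parts_def by (auto simp: mem_internal_vertices_iff path_nth)

lemma finite_parts: "v \<in> V \<Longrightarrow> finite (parts v)"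
  using parts_subset fin finite_subset by blast

lemma top_in_parts: "v \<in> V \<Longrightarrow> top v \<in> parts v"
  using finite_parts unfolding top_def by (intro Min_in) (auto simp: parts_def)

lemma top_le: "v \<in> V \<Longrightarrow> y \<in> parts v \<Longrightarrow> top v \<le> y"
  using finite_parts unfolding top_def by simp

lemma top_mem: "v \<in> V \<Longrightarrow> top v \<in> x ` V"
  using parts_subset top_in_parts by blast

lemma up_reach_along_path:
  assumes q: "q \<in> P" and i: "i < length q" and j: "j < length q"
    and y: "y \<in> up_reach U m (x (q ! j))"
    and le: "\<And>s. min i j \<le> s \<Longrightarrow> s \<le> max i j \<Longrightarrow> y \<le> x (q ! s)"
  shows "y \<in> up_reach U (m + (max i j - min i j)) (x (q ! i))"
proof -
  have adj': "x (q ! s) \<in> U (x (q ! Suc s)) \<or> x (q ! Suc s) \<in> U (x (q ! s))"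
    if "Suc s < length q" for s
    using adj[OF _ _ path_edge[OF q that]] path_nth[OF q] that by simp
  show ?thesis
  proof (cases "i \<le> j")
    case True
    have "y \<in> up_reach U (m + (j - i)) (x (q ! (i + 0)))"
    proof (rule up_reach_walk[where f = "\<lambda>s. x (q ! (i + s))"])
      fix s assume s: "s < j - i"
      show "x (q ! (i + s)) \<in> U (x (q ! (i + Suc s))) \<or> x (q ! (i + Suc s)) \<in> U (x (q ! (i + s)))"
        using adj'[of "i + s"] s j by simp
      show "y \<le> x (q ! (i + s))" using le[of "i + s"] True s by simp
    qed (use y True in simp)
    then show ?thesis using True by simp
  next
    case False
    have "y \<in> up_reach U (m + (i - j)) (x (q ! (i - 0)))"
    proof (rule up_reach_walk[where f = "\<lambda>s. x (q ! (i - s))"])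
      fix s assume s: "s < i - j"
      then have "i - s = Suc (i - Suc s)" by simp
      then show "x (q ! (i - s)) \<in> U (x (q ! (i - Suc s))) \<or> x (q ! (i - Suc s)) \<in> U (x (q ! (i - s)))"
        using adj'[of "i - Suc s"] s i by (metis diff_less_Suc le_less_trans less_Suc_eq_le diff_le_self)
      show "y \<le> x (q ! (i - s))" using le[of "i - s"] False s by simp
    qed (use y False in simp)
    then show ?thesis using False by simp
  qed
qed

text \<open>Between a vertex of the path and an internal one, every vertex other than the first is
  internal, so its part competes in the minimum defining \<open>top\<close>. This keeps walks along
  the path at or after the top.\<close>

lemma top_le_path:
  assumes q: "q \<in> P" and i: "i < length q" and j: "0 < j" "Suc j < length q"
    and s: "min i j \<le> s" "s \<le> max i j"
  shows "top (q ! i) \<le> x (q ! s)"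
proof (rule top_le[OF path_nth[OF q i]])
  show "x (q ! s) \<in> parts (q ! i)"
  proof (cases "s = i")
    case False
    then have "0 < s" "Suc s < length q" using i j s by (auto simp: min_def max_def split: if_splits)
    then have "q ! s \<in> internal_vertices q" by (auto simp: mem_internal_vertices_iff)
    then show ?thesis using q i unfolding parts_def by auto
  qed (simp add: parts_def)
qed

text \<open>A vertex \<open>u\<close> that provides a different top is internal, so its distance
  from \<open>v\<close> along a path of length at most \<open>k\<close> is at most
  \<open>k - 1\<close>.\<close>

lemma top_up_reach:
  assumes v: "v \<in> V"
  shows "top v \<in> up_reach U (k - 1) (x v)"
proof (cases "top v = x v")
  case False
  then obtain u q where uq: "top v = x u" "q \<in> P" "v \<in> set q" "u \<in> internal_vertices q"
    using top_in_parts[OF v] unfolding parts_def by blast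
  obtain i where i: "i < length q" "v = q ! i" using uq(3) by (metis in_set_conv_nth)
  obtain j where j: "0 < j" "Suc j < length q" "u = q ! j"
    using uq(4) by (auto simp: mem_internal_vertices_iff)
  have "top v \<in> up_reach U (0 + (max i j - min i j)) (x (q ! i))"
  proof (rule up_reach_along_path[OF uq(2) i(1)])
    show "top v \<le> x (q ! s)" if "min i j \<le> s" "s \<le> max i j" for s
      using top_le_path[OF uq(2) i(1) j(1,2) that] i(2) by simp
  qed (use j uq in simp_all)
  moreover have "max i j - min i j \<le> k - 1"
    using i j paths[OF uq(2)] by (auto simp: min_def max_def)
  ultimately show ?thesis using up_reach_mono i by simp
qed (simp add: self_up_reach)

lemma top_up_reach_internal:
  assumes q: "q \<in> P" and i: "i < length q" and j: "0 < j" "Suc j < length q"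
  shows "top (q ! i) \<in> up_reach U (k - 1 + (max j i - min j i)) (x (q ! j))"
proof (rule up_reach_along_path[OF q])
  show "top (q ! i) \<in> up_reach U (k - 1) (x (q ! i))"
    using top_up_reach path_nth[OF q i] .
  show "top (q ! i) \<le> x (q ! s)" if "min j i \<le> s" "s \<le> max j i" for s
    using top_le_path[OF q i j, of s] that by (simp add: min.commute max.commute)
qed (use i j in simp_all)

text \<open>One of the two parts lies in the bag of the other, and the latter serves as
  \<open>z\<close>: it spends at most one step before the \<open>k - 1\<close> steps to a
  top.\<close>

lemma graph_edge_tops_reachable:
  assumes v: "v \<in> V" and w: "w \<in> V" and e: "{v, w} \<in> E"
  shows "\<exists>z\<in>x ` V. top v \<in> up_reach U k z \<and> top w \<in> up_reach U k z"
proof -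
  have k: "k = Suc (k - 1)" using kpos by simp
  have "top a \<in> up_reach U k (x a)" if "a \<in> V" for a
    using top_up_reach[OF that] up_reach_Suc_mono k by metis
  moreover have "top b \<in> up_reach U k (x a)" if "b \<in> V" "x b \<in> U (x a)" for a b
  proof -
    have "top b \<in> up_reach U (Suc (k - 1)) (x a)" using top_up_reach[OF that(1)] that(2) by auto
    then show ?thesis using k by simp
  qed
  ultimately show ?thesis using adj[OF v w e] v w by blast
qed

text \<open>On a path with internal vertices, the neighbour of the end with the earlier top reaches
  that top in \<open>k\<close> steps, and it also reaches the other top. By
  \<open>up_reach_between\<close> the later top reaches the earlier one in \<open>k\<close> steps,
  so the later top serves as \<open>z\<close>.\<close>

lemma shortcut_tops_reachable:
  assumes q: "q \<in> P"
  shows "\<exists>z\<in>x ` V. top (hd q) \<in> up_reach U k z \<and> top (last q) \<in> up_reach U k z"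
proof -
  define n where "n = length q"
  have n: "2 \<le> n" "n - 1 \<le> k" "q \<noteq> []" using paths[OF q] unfolding n_def by auto
  have hd: "hd q = q ! 0" and last: "last q = q ! (n - 1)"
    using n by (simp_all add: hd_conv_nth last_conv_nth n_def)
  have V: "hd q \<in> V" "last q \<in> V" unfolding hd last using path_nth[OF q] n by (simp_all add: n_def)
  show ?thesis
  proof (cases "n = 2")
    case True
    then have "{hd q, last q} \<in> E" using path_edge[OF q, of 0] unfolding hd last n_def by simp
    then show ?thesis using graph_edge_tops_reachable V by blast
  next
    case False
    then have n3: "3 \<le> n" using n by simp
    then have idx: "0 < length q" "n - 1 < length q" "0 < (1::nat)" "Suc 1 < length q"
      "0 < n - 2" "Suc (n - 2) < length q" unfolding n_def by linarith+
    show ?thesis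
    proof (cases "top (last q) \<le> top (hd q)")
      case True
      have "top (last q) \<in> up_reach U k (x (q ! (n - 2)))"
      proof -
        have "k - 1 + (max (n - 2) (n - 1) - min (n - 2) (n - 1)) = k" using n3 kpos by simp
        then show ?thesis
          using top_up_reach_internal[OF q idx(2,5,6)] last by simp
      qed
      moreover obtain m where "top (hd q) \<in> up_reach U m (x (q ! (n - 2)))"
        using top_up_reach_internal[OF q idx(1,5,6)] hd by auto
      ultimately have "top (last q) \<in> up_reach U k (top (hd q))"
        using up_reach_between True by blast
      then show ?thesis using self_up_reach top_mem V by blast
    next
      case False
      have "top (hd q) \<in> up_reach U k (x (q ! 1))"
        using top_up_reach_internal[OF q idx(1,3,4)] kpos hd by simp
      moreover obtain m where "top (last q) \<in> up_reach U m (x (q ! 1))"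
        using top_up_reach_internal[OF q idx(2,3,4)] last by auto
      ultimately have "top (hd q) \<in> up_reach U k (top (last q))"
        using up_reach_between False by (meson linear)
      then show ?thesis using self_up_reach top_mem V by blast
    qed
  qed
qed

lemma tops_reachable:
  assumes "v \<in> V" and "w \<in> V" and "{v, w} \<in> shortcut_edges E P"
  shows "\<exists>z\<in>x ` V. top v \<in> up_reach U k z \<and> top w \<in> up_reach U k z"
  using assms(3) unfolding shortcut_edges_def
proof
  assume "{v, w} \<in> E"
  then show ?thesis using graph_edge_tops_reachable assms by blast
next
  assume "{v, w} \<in> {{hd p, last p} | p. p \<in> P}"
  then obtain q where "q \<in> P" "{v, w} = {hd q, last q}" by blast
  then show ?thesis using shortcut_tops_reachable[of q] by (auto simp: doubleton_eq_iff)
qed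

section \<open>Counting the vertices of a new part in a block of \<open>k\<close> layers\<close>

lemma finite_paths: "finite P"
proof (rule finite_subset)
  show "P \<subseteq> {q. set q \<subseteq> V \<and> length q \<le> k + 1}" using paths unfolding is_path_def by fastforce
  show "finite {q. set q \<subseteq> V \<and> length q \<le> k + 1}" using fin by (rule finite_lists_length_le)
qed

lemma layer_along_path:
  fixes lam :: "'a \<Rightarrow> nat"
  assumes lam: "\<And>u v. u \<in> V \<Longrightarrow> v \<in> V \<Longrightarrow> {u, v} \<in> E \<Longrightarrow> lam u \<le> lam v + 1"
    and q: "q \<in> P" and "i + s < length q"
  shows "lam (q ! i) \<le> lam (q ! (i + s)) + s \<and> lam (q ! (i + s)) \<le> lam (q ! i) + s"
  using \<open>i + s < length q\<close>
proof (induction s)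
  case (Suc s)
  let ?a = "q ! (i + s)" and ?b = "q ! Suc (i + s)"
  have e: "{?a, ?b} \<in> E" and "?a \<in> V" "?b \<in> V"
    using path_edge[OF q] path_nth[OF q] Suc.prems by auto
  then have "lam ?a \<le> lam ?b + 1" "lam ?b \<le> lam ?a + 1"
    using lam[of ?a ?b] lam[of ?b ?a] by (auto simp: insert_commute)
  then show ?case using Suc by simp
qed simp

lemma card_layer_top:
  fixes lam :: "'a \<Rightarrow> nat"
  assumes lam: "\<And>u v. u \<in> V \<Longrightarrow> v \<in> V \<Longrightarrow> {u, v} \<in> E \<Longrightarrow> lam u \<le> lam v + 1"
    and l: "\<And>i y. card {v \<in> V. lam v = i \<and> x v = y} \<le> l"
    and d: "\<And>v. v \<in> V \<Longrightarrow> card {q \<in> P. v \<in> internal_vertices q} \<le> d" and "0 < d"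
  shows "card {v \<in> V. lam v div k = j \<and> top v = y} \<le> d * l * (k ^ 3 + 3 * k)"
proof -
  define W where "W I = {v \<in> V. lam v \<in> I \<and> x v = y}" for I
  have W: "card (W I) \<le> card I * l" if "finite I" for I
  proof -
    have "W I = (\<Union>i\<in>I. {v \<in> V. lam v = i \<and> x v = y})" unfolding W_def by blast
    then have "card (W I) \<le> (\<Sum>i\<in>I. card {v \<in> V. lam v = i \<and> x v = y})"
      using card_UN_le[OF that] by simp
    also have "\<dots> \<le> (\<Sum>i\<in>I. l)" by (intro sum_mono l)
    finally show ?thesis by simp
  qed
  have finW: "finite (W I)" for I using fin unfolding W_def by simp
  define I where "I = {k * j..<k * j + k}"
  \<comment> \<open>These are the layers within distance \<open>k - 1\<close> of the block
    \<open>I\<close>: at most \<open>3 * k - 2\<close> of them, possibly fewer when truncated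
    subtraction cuts the lower end at 0.\<close>
  define I' where "I' = {k * j + 1 - k..<k * j + 2 * k - 1}"
  define Q where "Q u = {q \<in> P. u \<in> internal_vertices q}" for u
  have finQ: "finite (Q u)" for u using finite_paths unfolding Q_def by simp
  have cov: "{v \<in> V. lam v div k = j \<and> top v = y} \<subseteq> W I \<union> (\<Union>u\<in>W I'. \<Union>q\<in>Q u. set q)"
  proof
    fix v assume "v \<in> {v \<in> V. lam v div k = j \<and> top v = y}"
    then have v: "v \<in> V" "lam v div k = j" "top v = y" by auto
    have lv: "k * j \<le> lam v" "lam v < k * j + k"
      using v(2) div_mult_mod_eq[of "lam v" k] mod_less_divisor[OF kpos, of "lam v"]
      by (auto simp: mult.commute)
    show "v \<in> W I \<union> (\<Union>u\<in>W I'. \<Union>q\<in>Q u. set q)"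
    proof (cases "x v = y")
      case True
      then show ?thesis using v lv unfolding W_def I_def by simp
    next
      case False
      then obtain u q where uq: "y = x u" "q \<in> P" "v \<in> set q" "u \<in> internal_vertices q"
        using top_in_parts[OF v(1)] unfolding parts_def v(3) by blast
      obtain a where a: "a < length q" "v = q ! a" using uq(3) by (metis in_set_conv_nth)
      obtain b where b: "0 < b" "Suc b < length q" "u = q ! b"
        using uq(4) by (auto simp: mem_internal_vertices_iff)
      have len: "length q \<le> k + 1" using paths[OF uq(2)] by linarith
      have "lam u \<le> lam v + (k - 1) \<and> lam v \<le> lam u + (k - 1)"
      proof (cases "a \<le> b")
        case True
        then have "a + (b - a) = b" "b < length q" "b - a \<le> k - 1" using a b len by linarith+
        then show ?thesis using layer_along_path[of lam q a "b - a", OF lam uq(2)] a(2) b(3) by force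
      next
        case False
        then have "b + (a - b) = a" "a < length q" "a - b \<le> k - 1" using a b len by linarith+
        then show ?thesis using layer_along_path[of lam q b "a - b", OF lam uq(2)] a(2) b(3) by force
      qed
      then have "lam u \<in> I'" using lv kpos unfolding I'_def atLeastLessThan_iff by linarith
      moreover have "u \<in> V" using path_nth[OF uq(2)] b by simp
      ultimately have "u \<in> W I'" using uq(1) unfolding W_def by simp
      moreover have "q \<in> Q u" using uq unfolding Q_def by simp
      ultimately show ?thesis using uq(3) by blast
    qed
  qed
  have bd: "card (\<Union>q\<in>Q u. set q) \<le> d * (k + 1)" if u: "u \<in> W I'" for u
  proof -
    have "card (\<Union>q\<in>Q u. set q) \<le> (\<Sum>q\<in>Q u. card (set q))" by (rule card_UN_le[OF finQ])
    also have "\<dots> \<le> (\<Sum>q\<in>Q u. k + 1)"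
    proof (rule sum_mono)
      fix q assume "q \<in> Q u"
      then have "q \<in> P" unfolding Q_def by simp
      then have "length q \<le> k + 1" using paths[of q] by linarith
      then show "card (set q) \<le> k + 1" using card_length[of q] by simp
    qed
    also have "\<dots> = card (Q u) * (k + 1)" by simp
    also have "\<dots> \<le> d * (k + 1)"
      using d[of u] u unfolding Q_def W_def by (intro mult_le_mono1) simp
    finally show ?thesis .
  qed
  have "card (\<Union>u\<in>W I'. \<Union>q\<in>Q u. set q) \<le> (\<Sum>u\<in>W I'. card (\<Union>q\<in>Q u. set q))"
    by (rule card_UN_le[OF finW])
  also have "\<dots> \<le> (\<Sum>u\<in>W I'. d * (k + 1))" using bd by (rule sum_mono)
  also have "\<dots> = card (W I') * (d * (k + 1))" by simp
  also have "\<dots> \<le> ((3 * k - 2) * l) * (d * (k + 1))"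
  proof (rule mult_le_mono1)
    have "card I' \<le> 3 * k - 2" unfolding I'_def using kpos by simp
    then show "card (W I') \<le> (3 * k - 2) * l"
      using W[of I'] mult_le_mono1 order_trans unfolding I'_def by blast
  qed
  finally have c2: "card (\<Union>u\<in>W I'. \<Union>q\<in>Q u. set q) \<le> ((3 * k - 2) * l) * (d * (k + 1))" .
  \<comment> \<open>As \<open>0 < d\<close>, the vertices that stay in their part fit under the
    common factor \<open>d * l\<close>.\<close>
  have c1: "card (W I) \<le> d * (k * l)"
    using W[of I] \<open>0 < d\<close> unfolding I_def by (simp add: trans_le_add1 order_trans[of _ "k * l"])
  have "card {v \<in> V. lam v div k = j \<and> top v = y} \<le> card (W I \<union> (\<Union>u\<in>W I'. \<Union>q\<in>Q u. set q))"
    using cov finW finQ by (intro card_mono) auto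
  also have "\<dots> \<le> card (W I) + card (\<Union>u\<in>W I'. \<Union>q\<in>Q u. set q)" by (rule card_Un_le)
  also have "\<dots> \<le> d * (k * l) + ((3 * k - 2) * l) * (d * (k + 1))" using c1 c2 by (rule add_mono)
  also have "\<dots> = d * l * (k + (3 * k - 2) * (k + 1))" by (simp add: algebra_simps)
  also have "\<dots> \<le> d * l * (k ^ 3 + 3 * k)"
  proof (rule mult_le_mono2)
    \<comment> \<open>With \<open>k = n + 1\<close> the gap between the two sides is
      \<open>n ^ 3 + 1 - 2 * n\<close>.\<close>
    obtain n where n: "k = Suc n" using kpos by (cases k) auto
    have "2 * n \<le> n ^ 3 + 1"
    proof (cases "n \<le> 1")
      case False
      then have "2 * n \<le> n * n * n" by (intro mult_le_mono1) (simp add: le_square order_trans[of 2 n])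
      then show ?thesis unfolding power3_eq_cube by linarith
    qed (auto simp: le_Suc_eq)
    then show "k + (3 * k - 2) * (k + 1) \<le> k ^ 3 + 3 * k"
      unfolding n by (simp add: power3_eq_cube algebra_simps)
  qed
  finally show ?thesis .
qed

end

section \<open>The new partition, its layering and its tree decomposition\<close>

lemma layering_index:
  assumes "layering V E L"
  shows "\<exists>lam. (\<forall>v\<in>V. \<forall>i. v \<in> L i \<longleftrightarrow> i = lam v) \<and>
    (\<forall>u\<in>V. \<forall>v\<in>V. {u, v} \<in> E \<longrightarrow> lam u \<le> lam v + 1)"
proof -
  have U: "(\<Union>i. L i) = V" and dis: "\<And>i j. i \<noteq> j \<Longrightarrow> L i \<inter> L j = {}"
    and e: "\<And>i j v w. {v, w} \<in> E \<Longrightarrow> v \<in> L i \<Longrightarrow> w \<in> L j \<Longrightarrow> \<bar>int i - int j\<bar> \<le> 1"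
    using assms unfolding layering_def by blast+
  define lam where "lam v = (SOME i. v \<in> L i)" for v
  have lam: "v \<in> L (lam v)" if "v \<in> V" for v
    using that U unfolding lam_def by (metis UN_E someI)
  have "v \<in> L i \<longleftrightarrow> i = lam v" if "v \<in> V" for v i
    using lam[OF that] dis[of i "lam v"] by auto
  moreover have "lam u \<le> lam v + 1" if "u \<in> V" "v \<in> V" "{u, v} \<in> E" for u v
    using e[OF that(3) lam[OF that(1)] lam[OF that(2)]] by linarith
  ultimately show ?thesis by blast
qed

theorem theorem11:
  fixes V :: "'a set" and E :: "'a set set"
    and VH :: "'b set" and EH :: "'b set set" and S :: "'b \<Rightarrow> 'a set"
    and P :: "'a list set" and t l k d :: nat
  assumes "0 < t" and "0 < l" and "0 < k" and "0 < d"
    and "sgraph V E"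
    and "H_partition V E VH EH S"
    and "layered_width_le V E VH S l"
    and "treewidth_le VH EH t"
    and "shortcut_system V E P k d"
  shows "\<exists>(VJ :: nat set) EJ SJ.
           H_partition V (shortcut_edges E P) VJ EJ SJ \<and>
           layered_width_le V (shortcut_edges E P) VJ SJ (d * l * (k ^ 3 + 3 * k)) \<and>
           treewidth_le VJ EJ ((k + t choose t) - 1)"
proof -
  let ?E = "shortcut_edges E P"
  have finV: "finite V" using assms(5) unfolding sgraph_def by blast
  have finH: "finite VH" and SV: "(\<Union>h\<in>VH. S h) = V"
    and dis: "\<And>g h. g \<in> VH \<Longrightarrow> h \<in> VH \<Longrightarrow> g \<noteq> h \<Longrightarrow> S g \<inter> S h = {}"
    and quot: "\<And>g h. g \<in> VH \<Longrightarrow> h \<in> VH \<Longrightarrow>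
      {g, h} \<in> EH \<longleftrightarrow> (g \<noteq> h \<and> (\<exists>v\<in>S g. \<exists>w\<in>S h. {v, w} \<in> E))"
    using assms(6) unfolding H_partition_def sgraph_def by auto
  obtain L where L: "layering V E L" and Ll: "\<And>i h. h \<in> VH \<Longrightarrow> card (L i \<inter> S h) \<le> l"
    using assms(7) unfolding layered_width_le_def by blast
  obtain lam where lam: "\<And>v i. v \<in> V \<Longrightarrow> v \<in> L i \<longleftrightarrow> i = lam v"
    and lamE: "\<And>u v. u \<in> V \<Longrightarrow> v \<in> V \<Longrightarrow> {u, v} \<in> E \<Longrightarrow> lam u \<le> lam v + 1"
    using layering_index[OF L] by blast
  obtain \<nu> U where el: "elimination U" and cU: "\<And>i. card (U i) \<le> t + 1" and inj: "inj_on \<nu> VH"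
    and \<nu>: "\<And>g h. g \<in> VH \<Longrightarrow> h \<in> VH \<Longrightarrow> {g, h} \<in> EH \<Longrightarrow> \<nu> g \<in> U (\<nu> h) \<or> \<nu> h \<in> U (\<nu> g)"
    using elimination_if_treewidth_le[OF finH assms(8)] by blast
  interpret elimination U by (rule el)
  define part where "part v = (SOME h. h \<in> VH \<and> v \<in> S h)" for v
  have part: "part v \<in> VH \<and> v \<in> S (part v)" if "v \<in> V" for v
  proof -
    have "\<exists>h. h \<in> VH \<and> v \<in> S h" using that SV by blast
    then show ?thesis unfolding part_def by (rule someI_ex)
  qed
  \<comment> \<open>Parts are named by their positions in the elimination ordering, and the vertices
    of the new quotient are such positions.\<close>
  define x where "x v = \<nu> (part v)" for v
  interpret shortcut_parts U V E P k x
  proof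
    show "finite V" "0 < k" by fact+
    show "x u \<in> U (x v) \<or> x v \<in> U (x u)" if uv: "u \<in> V" "v \<in> V" "{u, v} \<in> E" for u v
    proof (cases "part u = part v")
      case True
      then show ?thesis using self unfolding x_def by simp
    next
      case False
      then have "{part u, part v} \<in> EH" using quot part uv by blast
      then show ?thesis using \<nu> part uv unfolding x_def by blast
    qed
    show "is_path V E q \<and> 2 \<le> length q \<and> length q - 1 \<le> k" if "q \<in> P" for q
      using assms(9) that unfolding shortcut_system_def by blast
  qed
  define VJ where "VJ = top ` V"
  define SJ where "SJ i = {v \<in> V. top v = i}" for i
  define EJ where "EJ = {{i, j} | i j. i \<in> VJ \<and> j \<in> VJ \<and> i \<noteq> j \<and> (\<exists>v\<in>SJ i. \<exists>w\<in>SJ j. {v, w} \<in> ?E)}"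
  have partJ: "H_partition V ?E VJ EJ SJ"
  proof -
    have "sgraph VJ EJ" unfolding sgraph_def EJ_def using finV unfolding VJ_def by blast
    moreover have "{i, j} \<in> EJ \<longleftrightarrow> (i \<noteq> j \<and> (\<exists>v\<in>SJ i. \<exists>w\<in>SJ j. {v, w} \<in> ?E))"
      if "i \<in> VJ" "j \<in> VJ" for i j
    proof
      assume "{i, j} \<in> EJ"
      then obtain i' j' v w where "{i, j} = {i', j'}" "i' \<noteq> j'" "v \<in> SJ i'" "w \<in> SJ j'" "{v, w} \<in> ?E"
        unfolding EJ_def by blast
      then show "i \<noteq> j \<and> (\<exists>v\<in>SJ i. \<exists>w\<in>SJ j. {v, w} \<in> ?E)"
        by (metis doubleton_eq_iff insert_commute)
    next
      assume "i \<noteq> j \<and> (\<exists>v\<in>SJ i. \<exists>w\<in>SJ j. {v, w} \<in> ?E)"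
      then show "{i, j} \<in> EJ" using that unfolding EJ_def by blast
    qed
    moreover have "\<forall>i\<in>VJ. SJ i \<noteq> {}" "(\<Union>i\<in>VJ. SJ i) = V" "\<forall>i\<in>VJ. \<forall>j\<in>VJ. i \<noteq> j \<longrightarrow> SJ i \<inter> SJ j = {}"
      unfolding VJ_def SJ_def by auto
    ultimately show ?thesis unfolding H_partition_def by blast
  qed
  \<comment> \<open>A shortcut spans at most \<open>k\<close> layers, so its ends lie in equal or
    adjacent blocks of \<open>k\<close> layers.\<close>
  define L' where "L' j = {v \<in> V. lam v div k = j}" for j
  have far: "lam v \<le> lam w + k \<and> lam w \<le> lam v + k" if vw: "{v, w} \<in> ?E" "v \<in> V" "w \<in> V" for v w
  proof (cases "{v, w} \<in> E")
    case True
    moreover then have "{w, v} \<in> E" by (simp add: insert_commute)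
    ultimately show ?thesis using lamE[of v w] lamE[of w v] vw \<open>0 < k\<close> by linarith
  next
    case False
    then obtain q where q: "q \<in> P" "{v, w} = {hd q, last q}"
      using vw(1) unfolding shortcut_edges_def by blast
    have len: "2 \<le> length q" "length q - 1 \<le> k" "q \<noteq> []" using paths[OF q(1)] by auto
    have "lam (hd q) \<le> lam (last q) + k \<and> lam (last q) \<le> lam (hd q) + k"
      using layer_along_path[of lam q 0 "length q - 1", OF lamE q(1)] len
      unfolding hd_conv_nth[OF len(3)] last_conv_nth[OF len(3)] by simp linarith
    then show ?thesis using q(2) by (auto simp: doubleton_eq_iff)
  qed
  have "layering V ?E L'"
    unfolding layering_def
  proof (intro conjI allI impI)
    show "(\<Union>i. L' i) = V" unfolding L'_def by blast
    show "L' i \<inter> L' j = {}" if "i \<noteq> j" for i j using that unfolding L'_def by blast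
    show "\<bar>int i - int j\<bar> \<le> 1" if "{v, w} \<in> ?E \<and> v \<in> L' i \<and> w \<in> L' j" for i j v w
    proof -
      have v: "{v, w} \<in> ?E" "v \<in> V" "w \<in> V" "lam v div k = i" "lam w div k = j"
        using that unfolding L'_def by auto
      have "a div k \<le> b div k + 1" if "a \<le> b + k" for a b
        using div_le_mono[OF that, of k] div_add_self2[of k b] \<open>0 < k\<close> by simp
      then have "i \<le> j + 1" "j \<le> i + 1" using far[OF v(1-3)] v(4,5) by blast+
      then show ?thesis by linarith
    qed
  qed
  moreover have "card (L' j \<inter> SJ y) \<le> d * l * (k ^ 3 + 3 * k)" for j y
  proof -
    \<comment> \<open>Injectivity of \<open>\<nu>\<close> puts all vertices with the same
      \<open>x\<close> into one original part, where the old width bound applies; a number that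
      names no part gives the empty set.\<close>
    have cl: "card {v \<in> V. lam v = i \<and> x v = y} \<le> l" for i y
    proof (cases "y \<in> \<nu> ` VH")
      case True
      then obtain h where h: "h \<in> VH" "y = \<nu> h" by blast
      have "{v \<in> V. lam v = i \<and> x v = y} \<subseteq> L i \<inter> S h"
      proof
        fix v assume "v \<in> {v \<in> V. lam v = i \<and> x v = y}"
        then have v: "v \<in> V" "lam v = i" "\<nu> (part v) = \<nu> h" using h unfolding x_def by auto
        then have "part v = h" using inj part h by (simp add: inj_on_eq_iff)
        then show "v \<in> L i \<inter> S h" using v part lam by auto
      qed
      moreover have "finite (L i \<inter> S h)" using h SV finV by (meson UN_upper finite_Int finite_subset)
      ultimately show ?thesis using Ll[OF h(1), of i] card_mono order_trans by blast
    next
      case False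
      then have "{v \<in> V. lam v = i \<and> x v = y} = {}" using part unfolding x_def by auto
      then show ?thesis by (metis card.empty le0)
    qed
    have cd: "card {q \<in> P. v \<in> internal_vertices q} \<le> d" if "v \<in> V" for v
      using assms(9) that unfolding shortcut_system_def by blast
    have "card {v \<in> V. lam v div k = j \<and> top v = y} \<le> d * l * (k ^ 3 + 3 * k)"
      using card_layer_top[of lam l d j y, OF lamE cl cd \<open>0 < d\<close>] .
    moreover have "L' j \<inter> SJ y = {v \<in> V. lam v div k = j \<and> top v = y}"
      unfolding L'_def SJ_def by blast
    ultimately show ?thesis by simp
  qed
  ultimately have width: "layered_width_le V ?E VJ SJ (d * l * (k ^ 3 + 3 * k))"
    unfolding layered_width_le_def by blast
  \<comment> \<open>All names of parts lie below \<open>M\<close>, which keeps the decomposition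
    tree finite.\<close>
  obtain M where M: "x ` V \<subseteq> {..<M}"
    using finV finite_nat_set_iff_bounded[of "x ` V"] by auto
  have "treewidth_le VJ EJ ((k + t choose t) - 1)"
  proof (rule treewidth_le_if_up_reach[OF el])
    show "card (up_reach U k i) \<le> (k + t choose t) - 1 + 1" for i
      using card_up_reach[OF el cU, of k i] by simp
    show "VJ \<subseteq> {..<M}" using top_mem M unfolding VJ_def by blast
    fix e assume "e \<in> EJ"
    then obtain v w where e: "v \<in> V" "w \<in> V" "{v, w} \<in> ?E" "e = {top v, top w}"
      unfolding EJ_def SJ_def by blast
    then obtain z where "z \<in> x ` V" "top v \<in> up_reach U k z" "top w \<in> up_reach U k z"
      using tops_reachable by blast
    then show "e \<subseteq> VJ \<and> (\<exists>z<M. e \<subseteq> up_reach U k z)" using e M unfolding VJ_def by blast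
  qed
  then show ?thesis using partJ width by blast
qed

end
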